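(* Let $n\ge1$ and let $T$ be an $n$-vertex tree. Then $\mathring{s}(T)\ge n+u_{n-1}$, with equality for the star $T=K_{1,n-1}$. Furthermore, if neither $n-1$ nor $n-2$ is a triangular number, then $K_{1,n-1}$ is the unique $n$-vertex tree $T$ with $\mathring{s}(T)=n+u_{n-1}$.
   Context: Slow-coloring game on a finite graph $G$: in each round Lister marks a nonempty set $M$ of currently uncolored vertices, scoring $|M|$ points; Painter then colors a subset of $M$ independent in $G$. The game ends when all vertices are colored. Painter minimizes and Lister maximizes the total score; the sum-color cost $\mathring{s}(G)$ is the value of the game. For integers $k\ge0$, $t_k=\binom{k+1}{2}$; a triangular number is $t_k$ with $k\ge1$; $u_r=\max\{k\ge0:t_k\le r\}$. $K_{1,n-1}$ is the star with $n-1$ leaves. *)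

theory Defs
  imports Main "Graph_Theory.Kuratowski"
begin

text \<open>
  Finite simple graphs are the library's \<open>graph\<close>: finite, symmetric, loop-free digraphs without
  parallel arcs. The library predicate \<open>tree\<close> is not usable for them, because its \<open>forest\<close> also
  forbids the closed walk \<open>u, v, u\<close> along a single undirected edge. Walks that satisfy \<open>cycle\<close>
  and have length at least 3 are exactly the cycles of the undirected graph.
\<close>

definition undirected_tree :: "('a, 'b) pre_digraph \<Rightarrow> bool" where
  "undirected_tree G \<longleftrightarrow>
     graph G \<and> Digraph_Component.connected G \<and>
     \<not> (\<exists>p. pre_digraph.cycle G p \<and> 3 \<le> length p)"

definition independent_in :: "('a, 'b) pre_digraph \<Rightarrow> 'a set \<Rightarrow> bool" where
  "independent_in G I \<longleftrightarrow> (\<forall>u\<in>I. \<forall>v\<in>I. \<not> u \<rightarrow>\<^bsub>G\<^esub> v)"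

text \<open>
  The slow-coloring game from the position in which \<open>U\<close> is the set of uncolored vertices:
  \<open>painter_holds G U k\<close> says that Painter can make the game end with Lister's further score at most
  \<open>k\<close>, and \<open>lister_forces G U k\<close> that Lister can make this score at least \<open>k\<close>.
  Painter may color no vertex in a round. Play that never ends has infinite score, which agrees
  with both definitions being inductive: Lister scores at least one point per round.
\<close>

text \<open>With \<open>U = {}\<close> the premise is vacuous: the game is over.\<close>

inductive painter_holds :: "('a, 'b) pre_digraph \<Rightarrow> 'a set \<Rightarrow> nat \<Rightarrow> bool"
  for G where
  "(\<And>M. M \<subseteq> U \<Longrightarrow> M \<noteq> {} \<Longrightarrow>
      card M \<le> k \<and>
      (\<exists>I. I \<subseteq> M \<and> independent_in G I \<and> painter_holds G (U - I) (k - card M)))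
   \<Longrightarrow> painter_holds G U k"

text \<open>Truncated subtraction is intended: once \<open>card M \<ge> k\<close>, nothing more has to be scored.\<close>

inductive lister_forces :: "('a, 'b) pre_digraph \<Rightarrow> 'a set \<Rightarrow> nat \<Rightarrow> bool"
  for G where
  "lister_forces G U 0"
| "M \<subseteq> U \<Longrightarrow> M \<noteq> {} \<Longrightarrow>
     (\<And>I. I \<subseteq> M \<Longrightarrow> independent_in G I \<Longrightarrow> lister_forces G (U - I) (k - card M))
   \<Longrightarrow> lister_forces G U k"

text \<open>On a finite simple graph the game is determined, so the value \<open>sum_color_cost\<close> is well defined.\<close>

lemma not_painter_holds_iff_lister_forces:
  assumes "finite U"
  shows "\<not> painter_holds G U k \<longleftrightarrow> lister_forces G U (Suc k)"
  using assms
proof (induction k arbitrary: U rule: less_induct)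
  case (less k)
  show ?case
  proof
    assume "\<not> painter_holds G U k"
    then obtain M where M: "M \<subseteq> U" "M \<noteq> {}"
      and fail: "\<not> (card M \<le> k \<and> (\<exists>I. I \<subseteq> M \<and> independent_in G I \<and>
                   painter_holds G (U - I) (k - card M)))"
      using painter_holds.intros by metis
    have pos: "0 < card M" using M less.prems finite_subset card_gt_0_iff by metis
    show "lister_forces G U (Suc k)"
    proof (rule lister_forces.intros(2)[OF M])
      fix I assume I: "I \<subseteq> M" "independent_in G I"
      show "lister_forces G (U - I) (Suc k - card M)"
      proof (cases "card M \<le> k")
        case True
        then have "\<not> painter_holds G (U - I) (k - card M)" using fail I by blast
        then show ?thesis
          using less.IH[of "k - card M" "U - I"] less.prems pos True by (simp add: Suc_diff_le)
      next
        case False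
        then show ?thesis by (simp add: lister_forces.intros(1))
      qed
    qed
  next
    assume "lister_forces G U (Suc k)"
    then obtain M where M: "M \<subseteq> U" "M \<noteq> {}"
      and L: "\<And>I. I \<subseteq> M \<Longrightarrow> independent_in G I \<Longrightarrow> lister_forces G (U - I) (Suc k - card M)"
      by (cases rule: lister_forces.cases) auto
    have pos: "0 < card M" using M less.prems finite_subset card_gt_0_iff by metis
    show "\<not> painter_holds G U k"
    proof
      assume "painter_holds G U k"
      then obtain I where le: "card M \<le> k" and I: "I \<subseteq> M" "independent_in G I"
        and P: "painter_holds G (U - I) (k - card M)"
        using M by (cases rule: painter_holds.cases) blast
      show False
        using less.IH[of "k - card M" "U - I"] less.prems pos le L[OF I] P by (simp add: Suc_diff_le)
    qed
  qed
qed

lemma painter_holds_mono: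
  assumes "painter_holds G U k" "k \<le> l"
  shows "painter_holds G U l"
  using assms
proof (induction arbitrary: l)
  case (1 U k)
  show ?case
  proof (rule painter_holds.intros)
    fix M assume M: "M \<subseteq> U" "M \<noteq> {}"
    from "1.IH"[OF this] "1.prems"
    show "card M \<le> l \<and> (\<exists>I. I \<subseteq> M \<and> independent_in G I \<and> painter_holds G (U - I) (l - card M))"
      by (meson diff_le_mono le_trans)
  qed
qed

lemma painter_holds_square:
  assumes "finite U" "\<And>v. \<not> v \<rightarrow>\<^bsub>G\<^esub> v"
  shows "painter_holds G U (card U * card U)"
  using assms
proof (induction "card U" arbitrary: U rule: less_induct)
  case less
  show ?case
  proof (rule painter_holds.intros)
    fix M assume M: "M \<subseteq> U" "M \<noteq> {}"
    then obtain v where v: "v \<in> M" by blast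
    then have c: "card (U - {v}) = card U - 1" "0 < card U"
      using M less.prems by (auto simp: card_gt_0_iff)
    have "card M \<le> card U" using M less.prems card_mono by metis
    obtain c where cc: "card U = Suc c" using c(2) by (cases "card U") auto
    have b: "card M \<le> card U * card U" "card (U - {v}) * card (U - {v}) \<le> card U * card U - card M"
      using \<open>card M \<le> card U\<close> by (simp_all add: c cc)
    have "painter_holds G (U - {v}) (card U * card U - card M)"
      using painter_holds_mono[OF less.hyps[of "U - {v}"] b(2)] c less.prems by auto
    then show "card M \<le> card U * card U \<and> (\<exists>I. I \<subseteq> M \<and> independent_in G I \<and>
        painter_holds G (U - I) (card U * card U - card M))"
      using b(1) v less.prems(2) by (intro conjI exI[of _ "{v}"]) (auto simp: independent_in_def)
  qed
qed

lemma game_value_iff_least: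
  assumes "finite U"
  shows "painter_holds G U k \<and> lister_forces G U k
    \<longleftrightarrow> painter_holds G U k \<and> (\<forall>j<k. \<not> painter_holds G U j)"
proof (cases k)
  case 0 then show ?thesis by (simp add: lister_forces.intros(1))
next
  case (Suc j)
  show ?thesis
    using not_painter_holds_iff_lister_forces[OF assms, of G j] painter_holds_mono[of G U] Suc by (metis less_Suc_eq_le lessI)
qed

lemma ex1_game_value:
  assumes "graph G"
  shows "\<exists>!k. painter_holds G (verts G) k \<and> lister_forces G (verts G) k"
proof -
  interpret graph G by fact
  have "painter_holds G (verts G) (card (verts G) * card (verts G))"
    by (rule painter_holds_square) (auto dest: adj_not_same)
  then show ?thesis
    unfolding game_value_iff_least[OF finite_verts] by (metis (full_types) exists_least_iff linorder_neqE_nat)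
qed

definition sum_color_cost :: "('a, 'b) pre_digraph \<Rightarrow> nat" where
  "sum_color_cost G =
     (THE k. painter_holds G (verts G) k \<and> lister_forces G (verts G) k)"

definition triangle_num :: "nat \<Rightarrow> nat" where
  "triangle_num k = (k + 1) choose 2"

definition triangular :: "nat \<Rightarrow> bool" where
  "triangular m \<longleftrightarrow> (\<exists>k\<ge>1. m = triangle_num k)"

definition triangle_root :: "nat \<Rightarrow> nat" where
  "triangle_root r = Max {k. triangle_num k \<le> r}"

end

theory Submission
  imports Defs
begin

text \<open>
  Lister may play separately on disjoint parts of the tree, so the cost is superadditive. A tree
  that is not a star splits along an edge into parts with \<open>a, b \<ge> 2\<close> vertices; for
  \<open>p = u\<^bsub>a-1\<^esub>\<close> and \<open>q = u\<^bsub>b-1\<^esub>\<close> we have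
  \<open>t\<^bsub>p+1\<^esub> + t\<^bsub>q+1\<^esub> = t\<^bsub>p+q+1\<^esub> + 1 - p q\<close>, whence
  \<open>n - 1 \<le> t\<^bsub>p+q+1\<^esub> - p q\<close> and \<open>u\<^bsub>n-1\<^esub> \<le> p + q\<close>. This gives the
  lower bound by induction from the stars, on which Lister marks the center and \<open>u\<^bsub>n-1\<^esub>\<close>
  leaves.

  If neither \<open>n - 1\<close> nor \<open>n - 2\<close> is triangular, \<open>p + q = k = u\<^bsub>n-1\<^esub>\<close> forces
  \<open>n = t\<^sub>k + 3\<close> and parts of sizes \<open>3\<close> and \<open>t\<^sub>k\<close>. By induction both parts are stars; unless
  the edge joins their centers, another edge gives a better split. The remaining double star is
  beaten by marking its large center and \<open>k\<close> of its leaves.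
\<close>

section \<open>Lister's strategies\<close>

lemma lister_forces_antimono:
  "lister_forces G U k \<Longrightarrow> j \<le> k \<Longrightarrow> lister_forces G U j"
proof (induction arbitrary: j rule: lister_forces.induct)
  case (1 U)
  then show ?case by (simp add: lister_forces.intros(1))
next
  case (2 M U k)
  show ?case
  proof (rule lister_forces.intros(2)[OF "2.hyps"(1,2)])
    fix I assume "I \<subseteq> M" "independent_in G I"
    then show "lister_forces G (U - I) (j - card M)"
      using "2.IH" "2.prems" diff_le_mono by blast
  qed
qed

lemma lister_forces_mono:
  "lister_forces G U k \<Longrightarrow> U \<subseteq> V \<Longrightarrow> lister_forces G V k"
proof (induction arbitrary: V rule: lister_forces.induct)
  case (1 U)
  then show ?case by (simp add: lister_forces.intros(1))
next
  case (2 M U k)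
  show ?case
  proof (rule lister_forces.intros(2)[of M])
    fix I assume "I \<subseteq> M" "independent_in G I"
    moreover have "U - I \<subseteq> V - I" using "2.prems" by blast
    ultimately show "lister_forces G (V - I) (k - card M)" using "2.IH" by blast
  qed (use "2.hyps" "2.prems" in blast)+
qed

text \<open>Lister plays out the strategy on \<open>U\<close> first and then the one on
  \<open>V\<close>; no move of the first touches \<open>V\<close>. If the target on \<open>U\<close>
  is met early, its leftover vertices are ignored by \<open>lister_forces_mono\<close>.\<close>

lemma lister_forces_Un:
  assumes "lister_forces G V l"
  shows "lister_forces G U k \<Longrightarrow> U \<inter> V = {} \<Longrightarrow> lister_forces G (U \<union> V) (k + l)"
proof (induction rule: lister_forces.induct)
  case (1 U)
  then show ?case using lister_forces_mono[OF assms] by simp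
next
  case (2 M U k)
  show ?case
  proof (rule lister_forces.intros(2)[of M])
    fix I assume I: "I \<subseteq> M" "independent_in G I"
    then have "U \<union> V - I = (U - I) \<union> V" using 2 by blast
    moreover have "lister_forces G ((U - I) \<union> V) (k - card M + l)"
      using 2 I by blast
    \<comment> \<open>Truncation can only make \<open>k - card M + l\<close> larger than
      \<open>k + l - card M\<close>.\<close>
    ultimately show "lister_forces G (U \<union> V - I) (k + l - card M)"
      by (auto elim!: lister_forces_antimono)
  qed (use "2.hyps" in blast)+
qed

lemma lister_forces_card:
  "finite U \<Longrightarrow> lister_forces G U (card U)"
proof (induction rule: finite_induct)
  case empty
  then show ?case by (simp add: lister_forces.intros(1))
next
  case (insert x U)
  have "lister_forces G {x} 1"
    by (rule lister_forces.intros(2)[of "{x}"]) (auto intro: lister_forces.intros)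
  from lister_forces_Un[OF insert.IH this] insert show ?case by simp
qed

section \<open>Triangular numbers and their inverse\<close>

lemma triangle_num_0 [simp]: "triangle_num 0 = 0"
  by (simp add: triangle_num_def)

lemma triangle_num_Suc [simp]: "triangle_num (Suc k) = triangle_num k + Suc k"
  by (simp add: triangle_num_def numeral_2_eq_2)

lemma triangle_num_mono: "j \<le> k \<Longrightarrow> triangle_num j \<le> triangle_num k"
  by (rule lift_Suc_mono_le[of triangle_num]) auto

lemma triangle_num_ge: "k \<le> triangle_num k"
  by (induction k) auto

text \<open>This Galois connection replaces \<open>Max\<close> in all later arguments; the set is
  finite because \<open>k \<le> triangle_num k\<close>.\<close>

lemma le_triangle_root_iff: "k \<le> triangle_root r \<longleftrightarrow> triangle_num k \<le> r"
proof -
  have fin: "finite {k. triangle_num k \<le> r}"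
    by (rule finite_subset[of _ "{..r}"]) (auto intro: le_trans[OF triangle_num_ge])
  have ne: "{k. triangle_num k \<le> r} \<noteq> {}"
    by (auto intro!: exI[of _ 0])
  show ?thesis
    unfolding triangle_root_def using Max_in[OF fin ne] Max_ge[OF fin, of k]
    by (auto dest: triangle_num_mono)
qed

lemma triangle_num_root_le: "triangle_num (triangle_root r) \<le> r"
  using le_triangle_root_iff by blast

lemma less_triangle_num_Suc_root: "r < triangle_num (Suc (triangle_root r))"
  using le_triangle_root_iff[of "Suc (triangle_root r)" r] by linarith

lemma triangle_num_add:
  "triangle_num (p + q) = triangle_num p + triangle_num q + p * q"
  by (induction q) (auto simp: algebra_simps)

text \<open>An independent answer to \<open>insert c S\<close> lies in \<open>{c}\<close> or in
  \<open>S\<close>. Coloring less only helps Lister, so \<open>U - {c}\<close> and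
  \<open>U - S\<close> are the worst positions that can follow.\<close>

lemma lister_forces_center:
  assumes "c \<notin> S" "finite S" "\<And>v. v \<in> S \<Longrightarrow> c \<rightarrow>\<^bsub>G\<^esub> v" "insert c S \<subseteq> U"
    and center: "lister_forces G (U - {c}) a" "k \<le> card S + 1 + a"
    and leaves: "lister_forces G (U - S) b" "k \<le> card S + 1 + b"
  shows "lister_forces G U k"
proof (rule lister_forces.intros(2)[of "insert c S"])
  fix I assume I: "I \<subseteq> insert c S" "independent_in G I"
  have k: "k - card (insert c S) \<le> a" "k - card (insert c S) \<le> b"
    using assms by auto
  show "lister_forces G (U - I) (k - card (insert c S))"
  proof (cases "c \<in> I")
    case True
    then have "I \<subseteq> {c}" using I assms(3) by (auto simp: independent_in_def)
    then show ?thesis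
      using lister_forces_mono[OF lister_forces_antimono[OF center(1) k(1)]] by blast
  next
    case False
    then have "I \<subseteq> S" using I by blast
    then show ?thesis
      using lister_forces_mono[OF lister_forces_antimono[OF leaves(1) k(2)]] by blast
  qed
qed (use assms in auto)

text \<open>Lister marks the center and as many leaves as the surplus aimed at. If the center is
  colored, every leaf still yields one point; if leaves are colored, at least
  \<open>triangle_num k\<close> remain for the induction. Both answers meet the target
  exactly.\<close>

lemma lister_forces_star:
  assumes "finite L" "c \<notin> L" "\<And>v. v \<in> L \<Longrightarrow> c \<rightarrow>\<^bsub>G\<^esub> v" "triangle_num k \<le> card L"
  shows "lister_forces G (insert c L) (card L + 1 + k)"
  using assms
proof (induction k arbitrary: L)
  case 0
  then show ?case using lister_forces_card[of "insert c L" G] by simp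
next
  case (Suc k)
  obtain S where S: "S \<subseteq> L" "card S = Suc k" "finite S"
    using Suc.prems(4) obtain_subset_with_card_n[of "Suc k" L] by auto
  have c: "card (L - S) = card L - Suc k"
    using S Suc.prems by (simp add: card_Diff_subset)
  have "lister_forces G (insert c (L - S)) (card (L - S) + 1 + k)"
    by (rule Suc.IH) (use Suc.prems c in auto)
  moreover have "insert c (L - S) = insert c L - S" using S Suc.prems by blast
  ultimately have leaves: "lister_forces G (insert c L - S) (card L - Suc k + 1 + k)" using c by simp
  have "insert c L - {c} = L" using Suc.prems by blast
  then have center: "lister_forces G (insert c L - {c}) (card L)"
    using lister_forces_card[OF Suc.prems(1), of G] by simp
  show ?case
    by (rule lister_forces_center[OF _ _ _ _ center _ leaves]) (use S Suc.prems in auto)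
qed

text \<open>The star strategy at \<open>c\<close> again, with surplus \<open>k + 2\<close> over the
  \<open>card C + 4\<close> vertices: the recursion ends in a claw at \<open>y\<close>, which
  supplies the additional points.\<close>

lemma lister_forces_double_star:
  assumes "finite C" "finite Y" "card Y = 2" "C \<inter> Y = {}" "c \<noteq> y"
    and "c \<notin> C" "c \<notin> Y" "y \<notin> C" "y \<notin> Y"
    and "\<And>v. v \<in> C \<Longrightarrow> c \<rightarrow>\<^bsub>G\<^esub> v" "\<And>v. v \<in> Y \<Longrightarrow> y \<rightarrow>\<^bsub>G\<^esub> v" "y \<rightarrow>\<^bsub>G\<^esub> c"
    and "triangle_num (Suc k) \<le> card C + 1"
  shows "lister_forces G (insert c C \<union> insert y Y) (card C + 6 + k)"
  using assms
proof (induction k arbitrary: C)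
  case 0
  \<comment> \<open>With \<open>c\<close> as third leaf of \<open>y\<close> and
    \<open>triangle_num 2 = 3\<close>, the claw has surplus 2; each vertex of \<open>C\<close> adds
    one point.\<close>
  have "lister_forces G (insert y (insert c Y)) (card (insert c Y) + 1 + 2)"
    by (rule lister_forces_star) (use 0 in \<open>auto simp: numeral_2_eq_2\<close>)
  from lister_forces_Un[OF lister_forces_card[OF \<open>finite C\<close>] this] 0
  have "lister_forces G (insert y (insert c Y) \<union> C) (6 + card C)" by auto
  moreover have "insert y (insert c Y) \<union> C = insert c C \<union> insert y Y" by blast
  ultimately show ?case by (simp add: add.commute)
next
  case (Suc k)
  obtain S where S: "S \<subseteq> C" "card S = Suc (Suc k)" "finite S"
    using Suc.prems(13) obtain_subset_with_card_n[of "Suc (Suc k)" C] by auto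
  have c: "card (C - S) = card C - Suc (Suc k)"
    using S Suc.prems(1) by (simp add: card_Diff_subset)
  have "lister_forces G (insert c (C - S) \<union> insert y Y) (card (C - S) + 6 + k)"
    by (rule Suc.IH) (use Suc.prems c in auto)
  moreover have "insert c (C - S) \<union> insert y Y = insert c C \<union> insert y Y - S"
    using S Suc.prems(4,6-9) by blast
  ultimately have leaves:
    "lister_forces G (insert c C \<union> insert y Y - S) (card C - Suc (Suc k) + 6 + k)"
    using c by simp
  \<comment> \<open>After \<open>c\<close> is colored, the star at \<open>y\<close> still has
    surplus 1, since \<open>triangle_num 1 \<le> 2\<close>.\<close>
  have "lister_forces G (insert y Y) (card Y + 1 + 1)"
    by (rule lister_forces_star) (use Suc.prems in auto)
  from lister_forces_Un[OF lister_forces_card[OF \<open>finite C\<close>] this]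
  have "lister_forces G (insert y Y \<union> C) (4 + card C)"
    using Suc.prems(3,4,8) by (simp add: Int_commute)
  moreover have "insert y Y \<union> C = insert c C \<union> insert y Y - {c}" using Suc.prems(4-9) by blast
  ultimately have center: "lister_forces G (insert c C \<union> insert y Y - {c}) (4 + card C)" by simp
  show ?case
    by (rule lister_forces_center[OF _ _ _ _ center _ leaves]) (use S Suc.prems in auto)
qed

section \<open>Splitting connected vertex sets\<close>

text \<open>For symmetric \<open>G\<close> these are the finite nonempty sets inducing a connected
  subgraph; growth by one adjacent vertex supplies the induction for
  \<open>star_or_splits\<close>.\<close>

inductive connected_set :: "('a, 'b) pre_digraph \<Rightarrow> 'a set \<Rightarrow> bool" for G where
  single: "connected_set G {v}"
| insert: "connected_set G U \<Longrightarrow> u \<in> U \<Longrightarrow> v \<notin> U \<Longrightarrow> u \<rightarrow>\<^bsub>G\<^esub> v \<Longrightarrow> connected_set G (insert v U)"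

text \<open>Edges between the other vertices are allowed; in trees acyclicity excludes them
  later.\<close>

definition star_center :: "('a, 'b) pre_digraph \<Rightarrow> 'a set \<Rightarrow> 'a \<Rightarrow> bool" where
  "star_center G U c \<longleftrightarrow> c \<in> U \<and> (\<forall>v\<in>U - {c}. c \<rightarrow>\<^bsub>G\<^esub> v)"

text \<open>Two vertices on each side make the triangle roots of both parts positive, and hence also
  the product in \<open>split_bound\<close>.\<close>

definition splits :: "('a, 'b) pre_digraph \<Rightarrow> 'a set \<Rightarrow> 'a set \<Rightarrow> 'a set \<Rightarrow> bool" where
  "splits G U A B \<longleftrightarrow> connected_set G A \<and> connected_set G B \<and> A \<inter> B = {} \<and> U = A \<union> B \<and>
     2 \<le> card A \<and> 2 \<le> card B \<and> (\<exists>a\<in>A. \<exists>b\<in>B. a \<rightarrow>\<^bsub>G\<^esub> b)"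

lemma connected_set_finite: "connected_set G U \<Longrightarrow> finite U"
  by (induction rule: connected_set.induct) auto

lemma star_center_connected_set:
  assumes "star_center G U c" "finite U"
  shows "connected_set G U"
proof -
  have "finite L \<Longrightarrow> c \<notin> L \<Longrightarrow> \<forall>v\<in>L. c \<rightarrow>\<^bsub>G\<^esub> v \<Longrightarrow> connected_set G (insert c L)" for L
  proof (induction L rule: finite_induct)
    case (insert x L)
    then show ?case
      using connected_set.insert[of G "insert c L" c x] by (auto simp: insert_commute)
  qed (simp add: connected_set.single)
  from this[of "U - {c}"] assms show ?thesis
    by (auto simp: star_center_def insert_absorb)
qed

lemma splits_commute:
  assumes "symmetric G" "splits G U A B"
  shows "splits G U B A"
  using assms arcs_ends_symmetric[OF assms(1)] unfolding splits_def by blast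

text \<open>Grow the set vertex by vertex. A split persists when \<open>v\<close> joins the part of
  its neighbor \<open>u\<close>. A star stays a star if \<open>u\<close> is its center or it
  consists of the center and \<open>u\<close> only; otherwise the pendant edge from \<open>u\<close>
  to \<open>v\<close> is split off.\<close>

lemma star_or_splits:
  assumes "symmetric G" "connected_set G U"
  shows "(\<exists>c. star_center G U c) \<or> (\<exists>A B. splits G U A B)"
  using assms(2)
proof (induction rule: connected_set.induct)
  case (single v)
  then show ?case by (auto simp: star_center_def)
next
  case (insert U u v)
  have sym: "v \<rightarrow>\<^bsub>G\<^esub> u" using arcs_ends_symmetric assms(1) insert.hyps by fast
  have fin: "finite U" using connected_set_finite insert.hyps by blast
  from insert.IH show ?case
  proof (elim disjE exE)
    fix c assume c: "star_center G U c"
    have cu: "c \<rightarrow>\<^bsub>G\<^esub> u" "u \<rightarrow>\<^bsub>G\<^esub> c" if "c \<noteq> u"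
      using c that insert.hyps(2) arcs_ends_symmetric[OF assms(1)]
      by (auto simp: star_center_def)
    show ?thesis
    proof (cases "u = c")
      case True
      then show ?thesis using c insert.hyps by (auto simp: star_center_def)
    next
      case False
      show ?thesis
      proof (cases "U = {c, u}")
        case True
        then have "star_center G (insert v U) u"
          using insert.hyps cu False by (auto simp: star_center_def)
        then show ?thesis by blast
      next
        case U: False
        have 1: "connected_set G {v, u}"
          using connected_set.insert[OF connected_set.single[of G u], of u v] insert.hyps by auto
        have "star_center G (U - {u}) c" using c False by (auto simp: star_center_def)
        then have 2: "connected_set G (U - {u})"
          by (rule star_center_connected_set) (simp add: fin)
        \<comment> \<open>A third vertex of the old star leaves two vertices in
          \<open>U - {u}\<close>.\<close>
        obtain x where "x \<in> U" "x \<noteq> c" "x \<noteq> u"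
          using U c insert.hyps(2) by (auto simp: star_center_def)
        then have "{c, x} \<subseteq> U - {u}" "card {c, x} = 2" using c False by (auto simp: star_center_def)
        then have 3: "2 \<le> card (U - {u})" using fin card_mono by (metis finite_Diff)
        have "splits G (insert v U) {v, u} (U - {u})"
          unfolding splits_def using 1 2 3 cu False insert.hyps(2,3) c card_2_iff[of "{v, u}"]
          by (auto simp: star_center_def)
        then show ?thesis by blast
      qed
    qed
  next
    fix A B assume s: "splits G U A B"
    then have "u \<in> A \<or> u \<in> B" using insert.hyps(2) by (simp add: splits_def)
    then obtain A B where AB: "splits G U A B" "u \<in> A"
      using s splits_commute[OF assms(1) s] by metis
    have "card A \<le> card (insert v A)" by (simp add: card_insert_le)
    then have "2 \<le> card (insert v A)" using AB by (simp add: splits_def)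
    then have "splits G (insert v U) (insert v A) B"
      using AB insert.hyps connected_set.insert[of G A u v]
      by (auto simp: splits_def)
    then show ?thesis by blast
  qed
qed

section \<open>Triangle roots of the two parts of a split\<close>

lemma root_pos: "2 \<le> a \<Longrightarrow> 1 \<le> triangle_root (a - 1)"
  unfolding le_triangle_root_iff by simp

text \<open>Add \<open>a \<le> triangle_num (Suc p)\<close> and
  \<open>b \<le> triangle_num (Suc q)\<close> and apply \<open>triangle_num_add\<close>. The product
  stands on the left to avoid truncated subtraction.\<close>

lemma split_bound:
  fixes a b :: nat
  assumes "2 \<le> a" "2 \<le> b"
  defines "p \<equiv> triangle_root (a - 1)" and "q \<equiv> triangle_root (b - 1)"
  shows "a + b - 1 + p * q \<le> triangle_num (Suc (p + q))"
proof -
  have "a - 1 < triangle_num (Suc p)" "b - 1 < triangle_num (Suc q)"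
    unfolding p_def q_def by (rule less_triangle_num_Suc_root)+
  moreover have "triangle_num (Suc (p + q)) + 1 = triangle_num (Suc p) + triangle_num (Suc q) + p * q"
    by (simp add: triangle_num_add)
  ultimately show ?thesis using assms(1,2) by linarith
qed

text \<open>A larger root would put \<open>triangle_num (Suc (p + q))\<close> at or below
  \<open>a + b - 1\<close>, leaving no room for the product \<open>p * q \<ge> 1\<close>.\<close>

lemma triangle_root_add_le:
  assumes "2 \<le> a" "2 \<le> b"
  shows "triangle_root (a + b - 1) \<le> triangle_root (a - 1) + triangle_root (b - 1)"
proof (rule ccontr)
  let ?p = "triangle_root (a - 1)" and ?q = "triangle_root (b - 1)"
  assume "\<not> ?thesis"
  then have "triangle_num (Suc (?p + ?q)) \<le> a + b - 1"
    unfolding not_le by (simp only: Suc_le_eq le_triangle_root_iff[symmetric])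
  moreover have "1 \<le> ?p * ?q" using root_pos[OF assms(1)] root_pos[OF assms(2)] by simp
  ultimately show False using split_bound[OF assms] by linarith
qed

text \<open>
  With \<open>n = a + b\<close>: \<open>n - 1 \<le> t\<^bsub>k+1\<^esub> - p q = t\<^sub>k + 2 - (p - 1) (q - 1)\<close>, while
  \<open>n - 1 \<ge> t\<^sub>k + 2\<close>.
\<close>

lemma triangle_root_add_eq:
  assumes a: "2 \<le> a" and b: "2 \<le> b"
    and nt: "\<not> triangular (a + b - 1)" "\<not> triangular (a + b - 2)"
    and le: "triangle_root (a - 1) + triangle_root (b - 1) \<le> triangle_root (a + b - 1)"
  defines "k \<equiv> triangle_root (a + b - 1)"
  shows "2 \<le> k" "a = 3 \<and> b = triangle_num k \<or> b = 3 \<and> a = triangle_num k"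
proof -
  define p q where "p = triangle_root (a - 1)" and "q = triangle_root (b - 1)"
  have pq: "1 \<le> p" "1 \<le> q" unfolding p_def q_def using root_pos a b by auto
  have k: "k = p + q"
    using triangle_root_add_le[OF a b] le unfolding k_def p_def q_def by simp
  show "2 \<le> k" using k pq by simp
  \<comment> \<open>\<open>triangle_num k\<close> is at most \<open>a + b - 1\<close> but equals
    neither excluded value, so it is at most \<open>a + b - 3\<close>.\<close>
  have "triangle_num k \<noteq> a + b - 1" "triangle_num k \<noteq> a + b - 2"
    using nt \<open>2 \<le> k\<close> unfolding triangular_def by (metis one_le_numeral order_trans)+
  moreover have "triangle_num k \<le> a + b - 1" unfolding k_def by (rule triangle_num_root_le)
  ultimately have lower: "triangle_num k + 3 \<le> a + b" by linarith
  have upper: "a + b - 1 + p * q \<le> triangle_num (Suc k)"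
    using split_bound[OF a b] unfolding k p_def q_def by simp
  obtain p' q' where p': "p = Suc p'" "q = Suc q'" using pq by (metis Suc_le_D One_nat_def)
  have "p * q = p' * q' + p' + q' + 1" "triangle_num (Suc k) = triangle_num k + p' + q' + 3"
    using k p' by auto
  with lower upper have "p' * q' = 0" by linarith
  have "a - 1 < triangle_num (Suc p)" "b - 1 < triangle_num (Suc q)"
    unfolding p_def q_def by (rule less_triangle_num_Suc_root)+
  then have bd: "a \<le> triangle_num (Suc p)" "b \<le> triangle_num (Suc q)" by linarith+
  from \<open>p' * q' = 0\<close> consider "p = 1" | "q = 1" using p' by auto
  \<comment> \<open>A part with root 1 has at most \<open>triangle_num 2 = 3\<close> vertices, the
    other at most \<open>triangle_num k\<close>; the lower bound on \<open>a + b\<close> forces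
    equality in both.\<close>
  then show "a = 3 \<and> b = triangle_num k \<or> b = 3 \<and> a = triangle_num k"
  proof cases
    case 1
    then have "a \<le> 3" "b \<le> triangle_num k" using bd k by auto
    then show ?thesis using lower by linarith
  next
    case 2
    then have "b \<le> 3" "a \<le> triangle_num k" using bd k by auto
    then show ?thesis using lower by linarith
  qed
qed

section \<open>The lower bound\<close>

lemma star_center_lister_forces:
  assumes "star_center G U c" "finite U"
  shows "lister_forces G U (card U + triangle_root (card U - 1))"
proof -
  have c: "card (U - {c}) = card U - 1" "insert c (U - {c}) = U" "1 \<le> card U"
    using assms by (auto simp: star_center_def Suc_le_eq card_gt_0_iff)
  have "lister_forces G (insert c (U - {c})) (card (U - {c}) + 1 + triangle_root (card U - 1))"
    by (rule lister_forces_star)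
      (use assms c triangle_num_root_le[of "card U - 1"] in \<open>auto simp: star_center_def\<close>)
  with c show ?thesis by simp
qed

lemma splits_card:
  "splits G U A B \<Longrightarrow> card U = card A + card B"
  unfolding splits_def by (metis card_Un_disjoint connected_set_finite)

text \<open>\<open>i\<close> and \<open>j\<close> are surpluses over the numbers of vertices;
  superadditivity adds them up.\<close>

lemma splits_lister_forces:
  assumes "splits G U A B" "lister_forces G A (card A + i)" "lister_forces G B (card B + j)"
    and "k \<le> i + j"
  shows "lister_forces G U (card U + k)"
proof -
  have "lister_forces G U (card A + i + (card B + j))"
    using lister_forces_Un[OF assms(3,2)] assms(1) by (simp add: splits_def)
  then show ?thesis
    by (rule lister_forces_antimono) (use assms(4) splits_card[OF assms(1)] in simp)
qed

lemma connected_set_lister_forces: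
  assumes "symmetric G" "connected_set G U"
  shows "lister_forces G U (card U + triangle_root (card U - 1))"
  using assms(2)
proof (induction "card U" arbitrary: U rule: less_induct)
  case less
  from star_or_splits[OF assms(1) less.prems] show ?case
  proof (elim disjE exE)
    fix c assume "star_center G U c"
    then show ?thesis
      using star_center_lister_forces[OF _ connected_set_finite[OF less.prems]] by simp
  next
    fix A B assume s: "splits G U A B"
    then have *: "connected_set G A" "connected_set G B" "2 \<le> card A" "2 \<le> card B"
      by (auto simp: splits_def)
    show ?thesis
      by (rule splits_lister_forces[OF s less.hyps[OF _ *(1)] less.hyps[OF _ *(2)]])
        (use * splits_card[OF s] triangle_root_add_le[OF *(3,4)] in auto)
  qed
qed

section \<open>One more point on graphs that are not stars\<close>

lemma star_or_splits_3:
  assumes "symmetric G" "connected_set G U" "card U = 3"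
  shows "\<exists>c. star_center G U c"
  \<comment> \<open>A split needs four vertices.\<close>
  using star_or_splits[OF assms(1,2)] assms(3) splits_card[of G U] by (fastforce simp: splits_def)

lemma triangle_root_triangle_num [simp]: "triangle_root (triangle_num k) = k"
proof (rule antisym)
  show "triangle_root (triangle_num k) \<le> k"
    using triangle_num_root_le[of "triangle_num k"]
      triangle_num_mono[of "Suc k" "triangle_root (triangle_num k)"] by (force simp: not_less_eq_eq)
qed (simp add: le_triangle_root_iff)

text \<open>The parts \<open>A\<close> and \<open>B\<close> have roots 1 and \<open>k - 1\<close>,
  one short of what is needed for \<open>Suc k\<close>. If the joining edge misses a center, moving
  that end to the other part repairs this; joined centers give a double star.\<close>

lemma joined_stars_lister_forces:
  assumes sym: "symmetric G" and A: "star_center G A y" "card A = 3"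
    and B: "star_center G B c" "finite B" "card B = triangle_num k" "2 \<le> k"
    and AB: "A \<inter> B = {}" "a \<in> A" "b \<in> B" "a \<rightarrow>\<^bsub>G\<^esub> b"
  shows "lister_forces G (A \<union> B) (card (A \<union> B) + Suc k)"
proof -
  have finA: "finite A" using A(2) card.infinite by fastforce
  have conn: "connected_set G A" "connected_set G B"
    using star_center_connected_set[OF A(1) finA] star_center_connected_set[OF B(1,2)] by simp_all
  have ba: "b \<rightarrow>\<^bsub>G\<^esub> a" using arcs_ends_symmetric[OF sym AB(4)] .
  have cardU: "card (A \<union> B) = 3 + triangle_num k"
    using A B AB finA by (simp add: card_Un_disjoint)
  have tk: "3 \<le> triangle_num k" using triangle_num_mono[OF B(4)] by (simp add: numeral_2_eq_2)
  note forces = connected_set_lister_forces[OF sym]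
  consider "a \<noteq> y" | "a = y" "b \<noteq> c" | "a = y" "b = c" by blast
  then show ?thesis
  proof cases
    \<comment> \<open>The sizes become 2 and \<open>triangle_num k + 1\<close>, with roots 1 and
      \<open>k\<close>.\<close>
    case 1
    have "card (A - {a}) = 2" using A AB finA by simp
    moreover have "star_center G (A - {a}) y" using A 1 by (auto simp: star_center_def)
    moreover have "y \<rightarrow>\<^bsub>G\<^esub> a" "y \<in> A" using A 1 AB by (auto simp: star_center_def)
    moreover have "connected_set G (insert a B)"
      using connected_set.insert[OF conn(2) AB(3) _ ba] AB by blast
    moreover have "card (insert a B) = Suc (triangle_num k)" using AB B
      by (metis card_insert_disjoint disjoint_iff)
    moreover have "A - {a} \<union> insert a B = A \<union> B" using AB by blast
    ultimately have s: "splits G (A \<union> B) (A - {a}) (insert a B)"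
      and card: "card (A - {a}) = 2" "card (insert a B) = Suc (triangle_num k)"
      unfolding splits_def using AB tk star_center_connected_set[of G "A - {a}" y] finA 1 by auto
    have "connected_set G (A - {a})" "connected_set G (insert a B)" using s by (auto simp: splits_def)
    then show ?thesis
      by (intro splits_lister_forces[OF s forces forces])
        (use root_pos[of 2] in \<open>auto simp: card\<close>)
  next
    \<comment> \<open>The sizes become 4 and \<open>triangle_num k - 1\<close>, with roots 2 and at
      least \<open>k - 1\<close>, because \<open>k \<ge> 2\<close>.\<close>
    case 2
    have "card (B - {b}) = triangle_num k - 1" using B AB by simp
    moreover have sc: "star_center G (B - {b}) c" using B 2 by (auto simp: star_center_def)
    moreover have "c \<rightarrow>\<^bsub>G\<^esub> b" "c \<in> B" using B 2 AB by (auto simp: star_center_def)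
    moreover have "connected_set G (insert b A)"
      using connected_set.insert[OF conn(1) AB(2) _ AB(4)] AB by blast
    moreover have "card (insert b A) = 4" using AB A finA
      by (subst card_insert_disjoint) auto
    moreover have "insert b A \<union> (B - {b}) = A \<union> B" using AB by blast
    moreover have "b \<rightarrow>\<^bsub>G\<^esub> c" using arcs_ends_symmetric[OF sym \<open>c \<rightarrow>\<^bsub>G\<^esub> b\<close>] .
    ultimately have s: "splits G (A \<union> B) (insert b A) (B - {b})"
      and card: "card (insert b A) = 4" "card (B - {b}) = triangle_num k - 1"
      unfolding splits_def using AB tk star_center_connected_set[OF sc] B(2) 2 by auto
    have "connected_set G (B - {b})" "connected_set G (insert b A)" using s by (auto simp: splits_def)
    moreover have "2 \<le> triangle_root 3" by (simp add: le_triangle_root_iff numeral_2_eq_2)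
    moreover have "k - 1 \<le> triangle_root (triangle_num k - 2)"
      unfolding le_triangle_root_iff using B(4) by (cases k) auto
    ultimately show ?thesis
      by (intro splits_lister_forces[OF s forces forces]) (use B(4) in \<open>auto simp: card numeral_2_eq_2\<close>)
  next
    \<comment> \<open>\<open>B - {c}\<close> has \<open>triangle_num k - 1\<close> vertices, so the
      size condition of the double star holds with equality for \<open>k = Suc k'\<close>.\<close>
    case 3
    have cy: "c \<in> B" "y \<in> A" using A B by (auto simp: star_center_def)
    have card: "card (B - {c}) = triangle_num k - 1" "card (A - {y}) = 2"
      using A B cy finA by auto
    obtain k' where k': "k = Suc k'" using B(4) by (cases k) auto
    have "lister_forces G (insert c (B - {c}) \<union> insert y (A - {y})) (card (B - {c}) + 6 + k')"
      by (rule lister_forces_double_star)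
        (use A B AB cy card 3 finA tk k' in \<open>auto simp: star_center_def\<close>)
    moreover have "insert c (B - {c}) \<union> insert y (A - {y}) = A \<union> B" using cy by blast
    moreover have "card (B - {c}) + 6 + k' = card (A \<union> B) + Suc k"
      using cardU card(1) tk k' by linarith
    ultimately show ?thesis by simp
  qed
qed

lemma not_star_lister_forces:
  assumes sym: "symmetric G"
  shows "connected_set G U \<Longrightarrow> \<nexists>c. star_center G U c \<Longrightarrow>
    \<not> triangular (card U - 1) \<Longrightarrow> \<not> triangular (card U - 2) \<Longrightarrow>
    lister_forces G U (card U + Suc (triangle_root (card U - 1)))"
proof (induction "card U" arbitrary: U rule: less_induct)
  case less
  obtain A B where AB: "splits G U A B"
    using star_or_splits[OF sym less.prems(1)] less.prems(2) by blast
  let ?k = "triangle_root (card U - 1)"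
  note c = splits_card
  have split: "connected_set G A" "connected_set G B" "2 \<le> card A" "2 \<le> card B"
    if "splits G U A B" for A B using that by (auto simp: splits_def)
  note forces = connected_set_lister_forces[OF sym]
  show ?case
  proof (cases "?k < triangle_root (card A - 1) + triangle_root (card B - 1)")
    case True
    show ?thesis
      by (rule splits_lister_forces[OF AB forces forces]) (use split[OF AB] True in auto)
  next
    case False
    then have k: "2 \<le> ?k"
      "card A = 3 \<and> card B = triangle_num ?k \<or> card B = 3 \<and> card A = triangle_num ?k"
      using triangle_root_add_eq[OF split(3)[OF AB] split(4)[OF AB]] less.prems(3,4) c[OF AB] by auto
    obtain A B where AB: "splits G U A B" "card A = 3" "card B = triangle_num ?k"
      using k(2) AB splits_commute[OF sym AB] by blast
    note AB' = split[OF AB(1)]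
    obtain y where y: "star_center G A y" using star_or_splits_3[OF sym AB'(1) AB(2)] by blast
    show ?thesis
    proof (cases "\<exists>c. star_center G B c")
      case True
      then obtain c where "star_center G B c" by blast
      then have "lister_forces G (A \<union> B) (card (A \<union> B) + Suc ?k)"
        using joined_stars_lister_forces[OF sym y AB(2) _ _ AB(3) k(1)] AB(1)
          connected_set_finite[OF AB'(2)] by (auto simp: splits_def)
      then show ?thesis using AB(1) by (simp add: splits_def)
    next
      \<comment> \<open>A three-vertex part would be a star, so \<open>?k \<ge> 3\<close>. Then
        \<open>card B - 1\<close> and \<open>card B - 2\<close> lie strictly between consecutive
        triangular numbers, and the induction hypothesis applies to \<open>B\<close>.\<close>
      case False
      have "?k \<noteq> 2" using False star_or_splits_3[OF sym AB'(2)] AB(3) by (auto simp: numeral_2_eq_2)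
      then obtain j where j: "?k = Suc (Suc (Suc j))"
        using k(1) that[of "?k - 3"] by simp
      have nt: "\<not> triangular m"
        if "triangle_num (Suc (Suc j)) < m" "m < triangle_num ?k" for m
      proof
        assume "triangular m"
        then obtain i where "m = triangle_num i" by (auto simp: triangular_def)
        then show False
          using that triangle_num_mono[of i "Suc (Suc j)"] triangle_num_mono[of ?k i] j
          by (metis leD not_less_eq_eq)
      qed
      have "\<not> triangular (card B - 1)" "\<not> triangular (card B - 2)"
        using AB(3) j by (intro nt; simp)+
      moreover have "card B < card U" using c[OF AB(1)] AB(2) by simp
      ultimately have "lister_forces G B (card B + Suc (triangle_root (card B - 1)))"
        using less.hyps[OF _ AB'(2) False] by blast
      then show ?thesis
      proof (rule splits_lister_forces[OF AB(1) forces[OF AB'(1)]])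
        \<comment> \<open>The roots of the parts sum to at least \<open>?k\<close>, and
          \<open>B\<close> contributes one more.\<close>
        show "Suc ?k \<le> triangle_root (card A - 1) + Suc (triangle_root (card B - 1))"
          using triangle_root_add_le[OF AB'(3,4)] c[OF AB(1)] by simp
      qed
    qed
  qed
qed

section \<open>Painter's strategy on a star\<close>

text \<open>Painter colors everything marked, so each vertex is marked once.\<close>

lemma painter_holds_independent:
  "finite L \<Longrightarrow> independent_in G L \<Longrightarrow> painter_holds G L (card L)"
proof (induction "card L" arbitrary: L rule: less_induct)
  case less
  show ?case
  proof (rule painter_holds.intros)
    fix M assume M: "M \<subseteq> L" "M \<noteq> {}"
    have "independent_in G M" "independent_in G (L - M)"
      using less.prems M by (auto simp: independent_in_def)
    moreover have "finite M" "card M \<le> card L" "card (L - M) = card L - card M" "0 < card M"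
      using M less.prems(1) by (auto simp: card_Diff_subset card_mono finite_subset card_gt_0_iff)
    ultimately show "card M \<le> card L \<and>
        (\<exists>I\<subseteq>M. independent_in G I \<and> painter_holds G (L - I) (card L - card M))"
      using less.hyps[of "L - M"] less.prems by (metis diff_less finite_Diff order_refl order.strict_trans2)
  qed
qed

text \<open>Painter colors the center when it is marked with at most
  \<open>triangle_root (card L)\<close> leaves; the leaves then cost one further point each.
  Otherwise Painter colors all marked leaves.\<close>

lemma painter_holds_star:
  "finite L \<Longrightarrow> c \<notin> L \<Longrightarrow> independent_in G L \<Longrightarrow> \<not> c \<rightarrow>\<^bsub>G\<^esub> c \<Longrightarrow>
    painter_holds G (insert c L) (card L + 1 + triangle_root (card L))"
proof (induction "card L" arbitrary: L rule: less_induct)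
  case less
  let ?u = "triangle_root (card L)"
  show ?case
  proof (rule painter_holds.intros)
    fix M assume M: "M \<subseteq> insert c L" "M \<noteq> {}"
    define S where "S = M - {c}"
    have S: "S \<subseteq> L" "finite S" "card S \<le> card L" "card (L - S) = card L - card S"
    proof -
      show "S \<subseteq> L" using M by (auto simp: S_def)
      with less.prems(1) show "finite S" "card S \<le> card L" "card (L - S) = card L - card S"
        by (auto simp: card_Diff_subset card_mono finite_subset)
    qed
    have ind: "independent_in G S" "independent_in G (L - S)" "independent_in G {c}"
      using less.prems S by (auto simp: independent_in_def)
    have rest: "painter_holds G (insert c L - S) (card L - card S + 1 + triangle_root (card L - card S))"
      if "S \<noteq> {}"
    proof -
      have "card S > 0" using that S by (simp add: card_gt_0_iff)
      then have "painter_holds G (insert c (L - S)) (card (L - S) + 1 + triangle_root (card (L - S)))"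
        using S less.prems ind that by (intro less.hyps) auto
      moreover have "insert c (L - S) = insert c L - S" using less.prems S by blast
      ultimately show ?thesis using S by simp
    qed
    show "card M \<le> card L + 1 + ?u \<and> (\<exists>I\<subseteq>M. independent_in G I \<and>
        painter_holds G (insert c L - I) (card L + 1 + ?u - card M))"
    proof (cases "c \<in> M")
      case False
      then have MS: "M = S" "S \<noteq> {}" using M by (auto simp: S_def)
      have "triangle_root (card L - card S) \<le> ?u"
        unfolding le_triangle_root_iff using triangle_num_root_le[of "card L - card S"] by linarith
      then have "painter_holds G (insert c L - S) (card L + 1 + ?u - card M)"
        using painter_holds_mono[OF rest[OF MS(2)]] S(3) MS by simp
      then show ?thesis using S(3) ind MS by auto
    next
      case True
      then have cM: "card M = Suc (card S)"
        using S by (metis S_def card_Suc_Diff1 finite_Diff2 finite_insert finite.emptyI)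
      show ?thesis
      proof (cases "card S \<le> ?u")
        case True
        have "insert c L - {c} = L" using less.prems by blast
        then have "painter_holds G (insert c L - {c}) (card L + 1 + ?u - card M)"
          using painter_holds_mono[OF painter_holds_independent[OF less.prems(1,3)]] True cM by simp
        then show ?thesis using \<open>c \<in> M\<close> ind cM True S(3) by (intro conjI exI[of _ "{c}"]) auto
      next
        \<comment> \<open>Coloring more than \<open>?u\<close> leaves lowers the root by at least
          one, which pays for the point scored on the uncolored center.\<close>
        case False
        then have ne: "S \<noteq> {}" by auto
        have "card L < triangle_num ?u + Suc ?u"
          using less_triangle_num_Suc_root[of "card L"] by simp
        then have "card L - card S < triangle_num ?u" using False S(3) by linarith
        then have "\<not> ?u \<le> triangle_root (card L - card S)" by (simp add: le_triangle_root_iff)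
        then have "painter_holds G (insert c L - S) (card L + 1 + ?u - card M)"
          using painter_holds_mono[OF rest[OF ne]] S(3) cM by simp
        moreover have "S \<subseteq> M" by (auto simp: S_def)
        moreover have "0 < ?u" using \<open>card L - card S < triangle_num ?u\<close> by (cases ?u) auto
        ultimately show ?thesis using ind cM S(3) by auto
      qed
    qed
  qed
qed

section \<open>Trees\<close>

lemma sum_color_cost_eq:
  assumes "graph G"
  shows "sum_color_cost G = k \<longleftrightarrow> painter_holds G (verts G) k \<and> lister_forces G (verts G) k"
  unfolding sum_color_cost_def using theI'[OF ex1_game_value[OF assms]] ex1_game_value[OF assms]
  by (metis (no_types, lifting))

lemma sum_color_cost_ge:
  assumes "graph G" "lister_forces G (verts G) k"
  shows "k \<le> sum_color_cost G"
proof -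
  interpret graph G by fact
  have "painter_holds G (verts G) (sum_color_cost G)" using sum_color_cost_eq[OF assms(1)] by blast
  then have "\<not> lister_forces G (verts G) (Suc (sum_color_cost G))"
    using not_painter_holds_iff_lister_forces[OF finite_verts] by blast
  then show ?thesis using lister_forces_antimono[OF assms(2)] not_less_eq_eq by blast
qed

text \<open>A maximal \<open>connected_set\<close> containing \<open>r\<close> absorbs, step by
  step, everything reachable from \<open>r\<close>.\<close>

lemma connected_set_verts:
  assumes "graph G" "Digraph_Component.connected G"
  shows "connected_set G (verts G)"
proof -
  interpret graph G by fact
  have sc: "strongly_connected G"
    using symmetric_connected_imp_strongly_connected[OF sym_arcs assms(2)] .
  then obtain r where r: "r \<in> verts G" by (auto simp: strongly_connected_def)
  let ?C = "{U. U \<subseteq> verts G \<and> connected_set G U}"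
  have "finite ?C" "{r} \<in> ?C" using r by (auto simp: connected_set.single)
  then obtain U where "U \<in> ?C" "{r} \<subseteq> U" "\<forall>V\<in>?C. U \<subseteq> V \<longrightarrow> U = V"
    using finite_has_maximal2[of ?C "{r}"] by auto
  then have U: "U \<in> ?C" "\<And>V. V \<in> ?C \<Longrightarrow> U \<subseteq> V \<Longrightarrow> U = V" and u: "r \<in> U"
    by auto
  have "v \<in> U" if "v \<in> verts G" for v
  proof -
    have "r \<rightarrow>\<^sup>*\<^bsub>G\<^esub> v" using sc that r by (auto simp: strongly_connected_def)
    then show ?thesis
    proof (induction rule: reachable_induct)
      case base
      then show ?case using u by simp
    next
      case (step x y)
      show ?case
      proof (rule ccontr)
        assume "y \<notin> U"
        then have "insert y U \<in> ?C"
          using connected_set.insert[of G U x y] U(1) step adj_in_verts by blast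
        with U(2) \<open>y \<notin> U\<close> show False by blast
      qed
    qed
  qed
  then have "U = verts G" using U(1) by blast
  with U(1) show ?thesis by simp
qed

lemma triangle_cycle:
  assumes "graph G" "u \<rightarrow>\<^bsub>G\<^esub> v" "v \<rightarrow>\<^bsub>G\<^esub> w" "w \<rightarrow>\<^bsub>G\<^esub> u"
  shows "\<exists>p. pre_digraph.cycle G p \<and> 3 \<le> length p"
proof -
  interpret graph G by fact
  obtain e f g where "e \<in> arcs G" "tail G e = u" "head G e = v" "f \<in> arcs G" "tail G f = v"
    "head G f = w" "g \<in> arcs G" "tail G g = w" "head G g = u"
    using assms by (auto simp: arcs_ends_conv)
  moreover have "u \<noteq> v" "v \<noteq> w" "w \<noteq> u" using assms adj_not_same by blast+
  ultimately have "cycle [e, f, g]"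
    unfolding cycle_def awalk_def by (intro exI[of _ u]) auto
  then show ?thesis by (intro exI[of _ "[e, f, g]"]) simp
qed

lemma star_center_undirected_tree_imp_bipartite:
  assumes "undirected_tree T" "star_center T (verts T) c"
  shows "K\<^bsub>1,card (verts T) - 1\<^esub> T"
proof -
  have T: "graph T" using assms(1) by (simp add: undirected_tree_def)
  then interpret graph T .
  have c: "c \<in> verts T" "\<And>v. v \<in> verts T \<Longrightarrow> v \<noteq> c \<Longrightarrow> c \<rightarrow>\<^bsub>T\<^esub> v"
    using assms(2) by (auto simp: star_center_def)
  note sym = arcs_ends_symmetric[OF sym_arcs]
  \<comment> \<open>An edge avoiding \<open>c\<close> would close a triangle with it.\<close>
  have "a = c \<or> b = c" if "a \<rightarrow>\<^bsub>T\<^esub> b" for a b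
    using triangle_cycle[OF T c(2) that sym[OF c(2)]] assms(1) adj_in_verts[OF that]
    by (auto simp: undirected_tree_def)
  then have "a \<rightarrow>\<^bsub>T\<^esub> b \<longleftrightarrow> a = c \<and> b \<in> verts T - {c} \<or> b = c \<and> a \<in> verts T - {c}" for a b
    using c(2) sym[of c] adj_in_verts[of a b] adj_not_same by blast
  then have "arcs_ends T = {c} \<times> (verts T - {c}) \<union> (verts T - {c}) \<times> {c}"
    by (auto simp: set_eq_iff)
  moreover have "verts T = {c} \<union> (verts T - {c})" "card (verts T - {c}) = card (verts T) - 1"
    using c(1) by auto
  ultimately show ?thesis unfolding complete_bipartite_digraph_def using T
    by (intro conjI exI[of _ "{c}"] exI[of _ "verts T - {c}"]) (simp_all del: insert_Diff_single)
qed

lemma complete_bipartite_star: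
  assumes "K\<^bsub>1,m\<^esub> T"
  obtains c L where "graph T" "verts T = insert c L" "c \<notin> L" "finite L" "card L = m"
    "arcs_ends T = {c} \<times> L \<union> L \<times> {c}"
proof -
  obtain U L where *: "graph T" "verts T = U \<union> L" "U \<inter> L = {}" "card U = 1" "card L = m"
    "arcs_ends T = U \<times> L \<union> L \<times> U"
    using assms unfolding complete_bipartite_digraph_def by blast
  interpret graph T by fact
  obtain c where "U = {c}" using *(4) by (rule card_1_singletonE)
  then show ?thesis using * finite_verts by (intro that[of c L]) auto
qed

text \<open>Every arc has exactly one end at \<open>c\<close>, so a walk visits \<open>c\<close> at
  every second step; a cycle of length at least 3 would visit it twice.\<close>

lemma complete_bipartite_star_undirected_tree:
  assumes "K\<^bsub>1,m\<^esub> T"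
  shows "undirected_tree T"
proof -
  obtain c L where T: "graph T" "verts T = insert c L" "c \<notin> L" "arcs_ends T = {c} \<times> L \<union> L \<times> {c}"
    using complete_bipartite_star[OF assms] by metis
  then interpret graph T by simp
  have c: "c \<rightarrow>\<^sup>*\<^bsub>T\<^esub> v" "v \<rightarrow>\<^sup>*\<^bsub>T\<^esub> c" if "v \<in> verts T" for v
    using that T by (cases "v = c"; auto)+
  have "strongly_connected T"
    using T(2) c reachable_trans by (intro strongly_connectedI) blast+
  then have conn: "Digraph_Component.connected T"
    unfolding Digraph_Component.connected_def strongly_connected_def
    by (auto intro: reachable_mk_symmetricI)
  have "False" if p: "cycle p" "3 \<le> length p" for p
  proof -
    obtain e1 e2 e3 q where q: "p = e1 # e2 # e3 # q"
      using p(2) by (cases p; cases "tl p"; cases "tl (tl p)") auto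
    obtain u where u: "awalk u p u" "distinct (tl (awalk_verts u p))"
      using p(1) by (auto simp: cycle_def)
    have arcs: "e1 \<in> arcs T" "e2 \<in> arcs T" "e3 \<in> arcs T" and t: "tail T e1 = u"
      "tail T e2 = head T e1" "tail T e3 = head T e2" and cas: "cas (head T e3) q u"
      using u(1) by (auto simp: q awalk_def)
    \<comment> \<open>The rest of the walk starts at \<open>head T e3\<close> and ends at
      \<open>u\<close>, also for \<open>q = []\<close>; distinctness thus separates these from the
      earlier tails.\<close>
    have in_q: "head T e3 \<in> set (awalk_verts (head T e3) q)" "u \<in> set (awalk_verts (head T e3) q)"
      using cas by (induction q arbitrary: e3) (auto simp: awalk_verts.simps)
    have d: "tail T e2 \<noteq> head T e3" "tail T e3 \<noteq> u"
      using u(2) in_q by (auto simp: q)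
    have "(tail T e = c) \<noteq> (head T e = c)" if "e \<in> arcs T" for e
    proof -
      have "(tail T e, head T e) \<in> arcs_ends T" using that by (auto simp: arcs_ends_conv)
      then show ?thesis using T(3) unfolding T(4) by auto
    qed
    from this[OF arcs(1)] this[OF arcs(2)] this[OF arcs(3)] show False
      using d unfolding t by (cases "head T e1 = c") auto
  qed
  with conn T(1) show ?thesis by (auto simp: undirected_tree_def)
qed

lemma complete_bipartite_star_cost:
  assumes "K\<^bsub>1,m\<^esub> T"
  shows "sum_color_cost T = m + 1 + triangle_root m"
proof -
  obtain c L where T: "graph T" "verts T = insert c L" "c \<notin> L" "finite L" "card L = m"
    "arcs_ends T = {c} \<times> L \<union> L \<times> {c}"
    using complete_bipartite_star[OF assms] .
  have "painter_holds T (insert c L) (card L + 1 + triangle_root (card L))"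
    by (rule painter_holds_star) (use T in \<open>auto simp: independent_in_def\<close>)
  moreover have "lister_forces T (insert c L) (card L + 1 + triangle_root (card L))"
    by (rule lister_forces_star) (use T triangle_num_root_le in auto)
  ultimately show ?thesis using T by (simp add: sum_color_cost_eq)
qed

text \<open>For \<open>n = 1\<close> the truncated \<open>n - 2\<close> is 0, which is no more
  triangular than -1.\<close>

theorem theorem4p3:
  fixes n :: nat
  assumes "n \<ge> 1"
  shows "(\<forall>T :: ('a, 'b) pre_digraph. undirected_tree T \<and> card (verts T) = n \<longrightarrow>
            sum_color_cost T \<ge> n + triangle_root (n - 1)) \<and>
         (\<forall>T :: ('a, 'b) pre_digraph. K\<^bsub>1,n - 1\<^esub> T \<longrightarrow>
            undirected_tree T \<and> card (verts T) = n \<and>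
            sum_color_cost T = n + triangle_root (n - 1)) \<and>
         (\<not> triangular (n - 1) \<and> \<not> triangular (n - 2) \<longrightarrow>
            (\<forall>T :: ('a, 'b) pre_digraph. undirected_tree T \<and> card (verts T) = n \<and>
               sum_color_cost T = n + triangle_root (n - 1) \<longrightarrow> K\<^bsub>1,n - 1\<^esub> T))"
proof (intro conjI allI impI; (elim conjE)?)
  fix T :: "('a, 'b) pre_digraph"
  assume T: "undirected_tree T" "card (verts T) = n"
  then have G: "graph T" "symmetric T" "connected_set T (verts T)"
    using connected_set_verts by (auto simp: undirected_tree_def graph_def pseudo_graph_def
        sym_digraph.sym_arcs)
  show "n + triangle_root (n - 1) \<le> sum_color_cost T"
    using sum_color_cost_ge[OF G(1) connected_set_lister_forces[OF G(2,3)]] T by simp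
  assume nt: "\<not> triangular (n - 1)" "\<not> triangular (n - 2)"
    and eq: "sum_color_cost T = n + triangle_root (n - 1)"
  have "\<exists>c. star_center T (verts T) c"
  proof (rule ccontr)
    assume "\<nexists>c. star_center T (verts T) c"
    from sum_color_cost_ge[OF G(1) not_star_lister_forces[OF G(2,3) this]] nt eq T
    show False by simp
  qed
  then show "K\<^bsub>1,n - 1\<^esub> T"
    using star_center_undirected_tree_imp_bipartite[OF T(1)] T(2) by blast
next
  fix T :: "('a, 'b) pre_digraph"
  assume T: "K\<^bsub>1,n - 1\<^esub> T"
  show "undirected_tree T" using complete_bipartite_star_undirected_tree[OF T] .
  show "card (verts T) = n" using complete_bipartite_star[OF T] assms
    by (metis Suc_diff_1 card_insert_disjoint less_eq_Suc_le One_nat_def)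
  show "sum_color_cost T = n + triangle_root (n - 1)"
    using complete_bipartite_star_cost[OF T] assms by simp
qed

end
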